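(* Let $R$ be a weakly p.q.-Baer $*$-ring and let $K$ be a commutative $*$-ring with unity such that $R$ is a $*$-algebra over $K$. Assume that for every $0\neq\lambda\in K$ there exists a projection $e_\lambda\in R$ such that for every $x\in R$, $\lambda x=0$ implies $C(x)\le e_\lambda$. Then $R$ can be embedded in a p.q.-Baer $*$-ring with preservation of central covers; that is, there exist a p.q.-Baer $*$-ring $S$ and an injective $*$-ring homomorphism $\varphi:R\to S$ such that for every $x\in R$ the central cover of $\varphi(x)$ in $S$ is $\varphi(C(x))$.
   Context: Rings are associative and need not have a unity. A $*$-ring is a ring with an involution $x\mapsto x^*$ (an additive anti-automorphism of period at most two); a $*$-ring homomorphism is a ring homomorphism commuting with the involutions. A projection is an element $e$ with $e=e^*=e^2$; projections are ordered by $e\le f$ iff $ef=e$ (equivalently $fe=e$). An element $x$ of a $*$-ring possesses a central cover if there is a smallest central projection $h$ in the ring such that $hx=x$; this $h$ is then unique and is denoted $C(x)$. A $*$-ring $S$ is a p.q.-Baer $*$-ring if for every principal right ideal $aS$ of $S$, the right annihilator $r_S(aS)=\{y\in S: sy=0\text{ for all }s\in aS\}$ equals $eS$ for some projection $e\in S$. (Such a ring has a unity, and every element of it has a central cover.) A $*$-ring $R$ is a weakly p.q.-Baer $*$-ring if every $x\in R$ has a central cover $e=C(x)\in R$ such that, for $y\in R$, $xRy=0$ if and only if $ey=0$. For a commutative $*$-ring $K$ with unity, $R$ is a $*$-algebra over $K$ if $R$ is a left $K$-module with $1a=a$, $\lambda(ab)=(\lambda a)b=a(\lambda b)$ and $(\lambda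 a)^*=\lambda^*a^*$ for all $\lambda\in K$, $a,b\in R$. *)

theory Defs
  imports "HOL-Algebra.Coset" "HOL-Algebra.Module"
begin

text \<open>
  Rings here need not have a unity, which rules out the locale \<^locale>\<open>ring\<close>. We use the
  library's ring records but put no condition on the field \<open>one\<close> unless \<open>cring\<close>
  is assumed; none of the definitions below mentions \<open>one\<close>. The involution is passed as a
  separate argument so that a \<open>*\<close>-algebra can still be a library module record.
\<close>

locale star_ring = abelian_group R for R (structure) +
  fixes star :: "'a \<Rightarrow> 'a"
  assumes m_closed: "\<lbrakk> x \<in> carrier R; y \<in> carrier R \<rbrakk> \<Longrightarrow> x \<otimes> y \<in> carrier R"
    and m_assoc: "\<lbrakk> x \<in> carrier R; y \<in> carrier R; z \<in> carrier R \<rbrakk>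
      \<Longrightarrow> (x \<otimes> y) \<otimes> z = x \<otimes> (y \<otimes> z)"
    and l_distr: "\<lbrakk> x \<in> carrier R; y \<in> carrier R; z \<in> carrier R \<rbrakk>
      \<Longrightarrow> (x \<oplus> y) \<otimes> z = x \<otimes> z \<oplus> y \<otimes> z"
    and r_distr: "\<lbrakk> x \<in> carrier R; y \<in> carrier R; z \<in> carrier R \<rbrakk>
      \<Longrightarrow> z \<otimes> (x \<oplus> y) = z \<otimes> x \<oplus> z \<otimes> y"
    and star_closed: "x \<in> carrier R \<Longrightarrow> star x \<in> carrier R"
    and star_add: "\<lbrakk> x \<in> carrier R; y \<in> carrier R \<rbrakk> \<Longrightarrow> star (x \<oplus> y) = star x \<oplus> star y"
    and star_mult: "\<lbrakk> x \<in> carrier R; y \<in> carrier R \<rbrakk> \<Longrightarrow> star (x \<otimes> y) = star y \<otimes> star x"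
    and star_star: "x \<in> carrier R \<Longrightarrow> star (star x) = x"

definition star_ring_hom ::
  "('a, 'm) ring_scheme \<Rightarrow> ('a \<Rightarrow> 'a) \<Rightarrow> ('b, 'n) ring_scheme \<Rightarrow> ('b \<Rightarrow> 'b) \<Rightarrow> ('a \<Rightarrow> 'b) set"
  where "star_ring_hom R starR S starS =
    {\<phi> \<in> carrier R \<rightarrow> carrier S.
      (\<forall>x\<in>carrier R. \<forall>y\<in>carrier R. \<phi> (x \<oplus>\<^bsub>R\<^esub> y) = \<phi> x \<oplus>\<^bsub>S\<^esub> \<phi> y) \<and>
      (\<forall>x\<in>carrier R. \<forall>y\<in>carrier R. \<phi> (x \<otimes>\<^bsub>R\<^esub> y) = \<phi> x \<otimes>\<^bsub>S\<^esub> \<phi> y) \<and>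
      (\<forall>x\<in>carrier R. \<phi> (starR x) = starS (\<phi> x))}"

definition projections :: "('a, 'm) ring_scheme \<Rightarrow> ('a \<Rightarrow> 'a) \<Rightarrow> 'a set"
  where "projections R star = {e \<in> carrier R. e = star e \<and> e = e \<otimes>\<^bsub>R\<^esub> e}"

definition proj_le :: "('a, 'm) ring_scheme \<Rightarrow> 'a \<Rightarrow> 'a \<Rightarrow> bool"
  where "proj_le R e f \<longleftrightarrow> e \<otimes>\<^bsub>R\<^esub> f = e"

definition central_projections :: "('a, 'm) ring_scheme \<Rightarrow> ('a \<Rightarrow> 'a) \<Rightarrow> 'a set"
  where "central_projections R star =
    {h \<in> projections R star. \<forall>y\<in>carrier R. h \<otimes>\<^bsub>R\<^esub> y = y \<otimes>\<^bsub>R\<^esub> h}"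

definition is_central_cover :: "('a, 'm) ring_scheme \<Rightarrow> ('a \<Rightarrow> 'a) \<Rightarrow> 'a \<Rightarrow> 'a \<Rightarrow> bool"
  where "is_central_cover R star x h \<longleftrightarrow>
    h \<in> central_projections R star \<and> h \<otimes>\<^bsub>R\<^esub> x = x \<and>
    (\<forall>g\<in>central_projections R star. g \<otimes>\<^bsub>R\<^esub> x = x \<longrightarrow> proj_le R h g)"

definition central_cover :: "('a, 'm) ring_scheme \<Rightarrow> ('a \<Rightarrow> 'a) \<Rightarrow> 'a \<Rightarrow> 'a"
  where "central_cover R star x = (THE h. is_central_cover R star x h)"

lemma is_central_cover_unique:
  assumes "is_central_cover R star x h" "is_central_cover R star x h'"
  shows "h = h'"
  using assms
  unfolding is_central_cover_def central_projections_def projections_def proj_le_def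
  by (smt (verit, best) mem_Collect_eq)

lemma central_cover_eq: "is_central_cover R star x h \<Longrightarrow> central_cover R star x = h"
  unfolding central_cover_def by (blast intro: is_central_cover_unique)

definition right_annihilator :: "('a, 'm) ring_scheme \<Rightarrow> 'a set \<Rightarrow> 'a set"
  where "right_annihilator R A = {y \<in> carrier R. \<forall>s\<in>A. s \<otimes>\<^bsub>R\<^esub> y = \<zero>\<^bsub>R\<^esub>}"

text \<open>The left cosets \<open>a <# carrier S\<close> are the principal right ideals \<open>aS\<close>.\<close>

definition pq_baer_star_ring :: "('a, 'm) ring_scheme \<Rightarrow> ('a \<Rightarrow> 'a) \<Rightarrow> bool"
  where "pq_baer_star_ring S star \<longleftrightarrow> star_ring S star \<and>
    (\<forall>a\<in>carrier S. \<exists>e\<in>projections S star.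
      right_annihilator S (a <#\<^bsub>S\<^esub> carrier S) = e <#\<^bsub>S\<^esub> carrier S)"

definition weakly_pq_baer_star_ring :: "('a, 'm) ring_scheme \<Rightarrow> ('a \<Rightarrow> 'a) \<Rightarrow> bool"
  where "weakly_pq_baer_star_ring R star \<longleftrightarrow> star_ring R star \<and>
    (\<forall>x\<in>carrier R. \<exists>e. is_central_cover R star x e \<and>
      (\<forall>y\<in>carrier R.
        (\<forall>r\<in>carrier R. x \<otimes>\<^bsub>R\<^esub> r \<otimes>\<^bsub>R\<^esub> y = \<zero>\<^bsub>R\<^esub>) \<longleftrightarrow> e \<otimes>\<^bsub>R\<^esub> y = \<zero>\<^bsub>R\<^esub>))"

text \<open>
  The locale \<^locale>\<open>module\<close> makes \<open>K\<close> a commutative ring with unity and, including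
  \<open>\<one> \<odot> a = a\<close>, provides the module laws; it uses only the additive group of \<open>R\<close>.
\<close>

locale star_algebra = module K R + K: star_ring K starK + R: star_ring R starR
  for K (structure) and starK and R (structure) and starR +
  assumes smult_assoc_left: "\<lbrakk> l \<in> carrier K; a \<in> carrier R; b \<in> carrier R \<rbrakk>
      \<Longrightarrow> l \<odot>\<^bsub>R\<^esub> (a \<otimes>\<^bsub>R\<^esub> b) = (l \<odot>\<^bsub>R\<^esub> a) \<otimes>\<^bsub>R\<^esub> b"
    and smult_assoc_right: "\<lbrakk> l \<in> carrier K; a \<in> carrier R; b \<in> carrier R \<rbrakk>
      \<Longrightarrow> (l \<odot>\<^bsub>R\<^esub> a) \<otimes>\<^bsub>R\<^esub> b = a \<otimes>\<^bsub>R\<^esub> (l \<odot>\<^bsub>R\<^esub> b)"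
    and star_smult: "\<lbrakk> l \<in> carrier K; a \<in> carrier R \<rbrakk>
      \<Longrightarrow> starR (l \<odot>\<^bsub>R\<^esub> a) = starK l \<odot>\<^bsub>R\<^esub> starR a"

end

theory Submission
  imports Defs "HOL-Algebra.QuotRing" "HOL-Algebra.Multiplicative_Group"
begin

text \<open>
  Adjoin the scalars: \<open>R \<times> K\<close>, with the product of formal sums
  \<open>a + \<lambda>\<close>, is a unital \<open>*\<close>-ring that acts on \<open>R\<close> from the left by
  \<open>(a + \<lambda>) x = a x + \<lambda> x\<close>. Let \<open>S\<close> be its quotient by the kernel of this action. Since
  \<open>C(x) x = x C(x) = x\<close>, no nonzero element of \<open>R\<close> annihilates all of \<open>R\<close> from either side.
  This makes the kernel closed under the involution and keeps \<open>R\<close> embedded in \<open>S\<close>, as an ideal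
  on which \<open>S\<close> acts faithfully.

  It is enough that every \<open>s \<in> S\<close> has a central projection
  \<open>p\<close> with \<open>s S y = 0 \<longleftrightarrow> p y = 0\<close>. In the presence of a unity such a \<open>p\<close> is automatically the
  central cover of \<open>s\<close>, and the right annihilator of \<open>s S\<close> is \<open>(1 - p) S\<close>. By faithfulness,
  an equation in \<open>S\<close> may be tested after multiplication by elements of the ideal \<open>R\<close>.

  For \<open>s = x \<in> R\<close> this testing shows that \<open>C(x)\<close>, which works in \<open>R\<close>,
  still works in \<open>S\<close>; in particular central covers are preserved.

  For \<open>s = a + \<lambda>\<close> with \<open>\<lambda> \<noteq> 0\<close>, let \<open>g\<close> be the join of \<open>C(a)\<close> and \<open>C(e\<^sub>\<lambda>)\<close>.
  On \<open>(1 - g) R\<close> the element \<open>a\<close> acts as zero, and \<open>\<lambda>\<close> acts injectively by the hypothesis on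
  \<open>e\<^sub>\<lambda>\<close>; hence \<open>s x = 0\<close> forces \<open>x \<in> g R\<close>. So the part of \<open>s\<close> below \<open>1 - g\<close> has cover
  \<open>1 - g\<close>, while the part below \<open>g\<close> is \<open>s g \<in> R\<close>, with cover \<open>C(s g) \<le> g\<close>. Together
  \<open>p = (1 - g) + C(s g)\<close>.
\<close>

section \<open>Central projections that control an annihilator\<close>

text \<open>
  The annihilator half of the condition for a weakly p.q.-Baer \<open>*\<close>-ring, separated from the
  minimality of central covers: it is this half that passes from \<open>R\<close> to the extension, where the
  unity then yields the minimality.
\<close>

definition annihilation_cover :: "('a, 'm) ring_scheme \<Rightarrow> ('a \<Rightarrow> 'a) \<Rightarrow> 'a \<Rightarrow> 'a \<Rightarrow> bool"
  where "annihilation_cover R star x e \<longleftrightarrow>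
    e \<in> central_projections R star \<and>
    (\<forall>y\<in>carrier R.
      (\<forall>r\<in>carrier R. x \<otimes>\<^bsub>R\<^esub> r \<otimes>\<^bsub>R\<^esub> y = \<zero>\<^bsub>R\<^esub>) \<longleftrightarrow> e \<otimes>\<^bsub>R\<^esub> y = \<zero>\<^bsub>R\<^esub>)"

lemma central_projectionsD:
  assumes "e \<in> central_projections R star"
  shows "e \<in> carrier R" "star e = e" "e \<otimes>\<^bsub>R\<^esub> e = e"
    "\<And>y. y \<in> carrier R \<Longrightarrow> e \<otimes>\<^bsub>R\<^esub> y = y \<otimes>\<^bsub>R\<^esub> e"
proof -
  have h: "e \<in> carrier R \<and> e = star e \<and> e = e \<otimes>\<^bsub>R\<^esub> e \<and>
      (\<forall>y\<in>carrier R. e \<otimes>\<^bsub>R\<^esub> y = y \<otimes>\<^bsub>R\<^esub> e)"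
    using assms unfolding central_projections_def projections_def by blast
  show "e \<in> carrier R" using h by blast
  show "star e = e" by (rule sym) (use h in blast)
  show "e \<otimes>\<^bsub>R\<^esub> e = e" by (rule sym) (use h in blast)
  show "e \<otimes>\<^bsub>R\<^esub> y = y \<otimes>\<^bsub>R\<^esub> e" if "y \<in> carrier R" for y using h that by blast
qed

lemma central_projectionsI:
  assumes "e \<in> carrier R" "star e = e" "e \<otimes>\<^bsub>R\<^esub> e = e"
    "\<And>y. y \<in> carrier R \<Longrightarrow> e \<otimes>\<^bsub>R\<^esub> y = y \<otimes>\<^bsub>R\<^esub> e"
  shows "e \<in> central_projections R star"
  unfolding central_projections_def projections_def
  using assms(1) assms(2,3)[symmetric] assms(4) by blast

context star_ring
begin

lemma l_zero_mult [simp]: "x \<in> carrier R \<Longrightarrow> \<zero> \<otimes> x = \<zero>"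
  using l_distr[of \<zero> \<zero> x] m_closed[of \<zero> x] by (simp add: add.l_cancel_one)

lemma r_zero_mult [simp]: "x \<in> carrier R \<Longrightarrow> x \<otimes> \<zero> = \<zero>"
  using r_distr[of \<zero> \<zero> x] m_closed[of x \<zero>] by (simp add: add.l_cancel_one)

lemma l_minus_mult:
  assumes "x \<in> carrier R" "y \<in> carrier R"
  shows "(\<ominus> x) \<otimes> y = \<ominus> (x \<otimes> y)"
proof -
  have "(\<ominus> x) \<otimes> y \<oplus> x \<otimes> y = \<zero>"
    using assms l_distr[of "\<ominus> x" x y] by (simp add: l_neg)
  then show ?thesis using assms by (simp add: m_closed minus_equality)
qed

lemma r_minus_mult:
  assumes "x \<in> carrier R" "y \<in> carrier R"
  shows "y \<otimes> (\<ominus> x) = \<ominus> (y \<otimes> x)"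
proof -
  have "y \<otimes> (\<ominus> x) \<oplus> y \<otimes> x = \<zero>"
    using assms r_distr[of "\<ominus> x" x y] by (simp add: l_neg)
  then show ?thesis using assms by (simp add: m_closed minus_equality)
qed

lemma star_zero [simp]: "star \<zero> = \<zero>"
  using star_add[of \<zero> \<zero>] star_closed[of \<zero>] by (simp add: add.l_cancel_one)

lemma star_minus:
  assumes "x \<in> carrier R"
  shows "star (\<ominus> x) = \<ominus> star x"
proof -
  have "star (\<ominus> x) \<oplus> star x = \<zero>"
    using assms star_add[of "\<ominus> x" x] by (simp add: l_neg)
  then show ?thesis using assms by (simp add: star_closed minus_equality)
qed

text \<open>
  The join of commuting projections is \<open>h + k - h k\<close>; without a unity it cannot be obtained from
  complements. The conclusion says that \<open>g\<close> is an upper bound, in the form in which it makes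
  \<open>x - g x\<close> vanish under both \<open>h\<close> and \<open>k\<close>.
\<close>

lemma central_projections_join:
  assumes h: "h \<in> central_projections R star" and k: "k \<in> central_projections R star"
  obtains g where "g \<in> central_projections R star" "h \<otimes> g = h" "k \<otimes> g = k"
proof -
  note hD = central_projectionsD[OF h] and kD = central_projectionsD[OF k]
  note cl = hD(1) kD(1) m_closed[OF hD(1) kD(1)]
  define g where "g = h \<oplus> (k \<oplus> \<ominus> (h \<otimes> k))"
  have g: "g \<in> carrier R" unfolding g_def using cl by simp
  have hg: "h \<otimes> g = h"
    unfolding g_def using cl
    by (simp add: r_distr r_minus_mult m_closed m_assoc[symmetric] hD(3) r_neg)
  have "k \<otimes> (h \<otimes> k) = h \<otimes> k"
    using cl by (metis kD(3,4) m_assoc)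
  then have kg: "k \<otimes> g = k"
    unfolding g_def using cl
    by (simp add: r_distr r_minus_mult m_closed hD(4)[OF kD(1)] kD(3) a_lcomm r_neg)
  have "g \<otimes> g = h \<otimes> g \<oplus> (k \<otimes> g \<oplus> \<ominus> (h \<otimes> (k \<otimes> g)))"
    using cl g by (subst (1) g_def) (simp add: l_distr l_minus_mult m_closed m_assoc)
  then have gg: "g \<otimes> g = g" by (simp only: hg kg g_def[symmetric])
  have sg: "star g = g"
    unfolding g_def using cl
    by (simp add: star_add star_minus star_mult hD(2) kD(2) hD(4)[OF kD(1)])
  have gc: "g \<otimes> y = y \<otimes> g" if y: "y \<in> carrier R" for y
  proof -
    have "h \<otimes> k \<otimes> y = y \<otimes> (h \<otimes> k)"
      using cl y by (metis hD(4) kD(4) m_assoc)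
    then show ?thesis
      unfolding g_def using cl y
      by (simp add: l_distr r_distr l_minus_mult r_minus_mult m_closed hD(4)[OF y] kD(4)[OF y])
  qed
  have "g \<in> central_projections R star" using g sg gg gc by (rule central_projectionsI)
  then show thesis using hg kg by (rule that)
qed

end

section \<open>Annihilator control in unital rings\<close>

locale unital_star_ring = ring S + star_ring S star for S (structure) and star
begin

lemma star_one: "star \<one> = \<one>"
proof -
  have "x \<otimes> star \<one> = x" if "x \<in> carrier S" for x
    using star_mult[of \<one> "star x"] that by (simp add: star_closed star_star)
  from this[of \<one>] show ?thesis by (simp add: star_closed)
qed

lemma complement_central:
  assumes g: "g \<in> central_projections S star"
  shows "\<one> \<ominus> g \<in> central_projections S star"
proof -
  note gD = central_projectionsD[OF g]
  show ?thesis
  proof (rule central_projectionsI)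
    show "star (\<one> \<ominus> g) = \<one> \<ominus> g"
      using gD(1) by (simp add: minus_eq star_add star_minus star_one gD(2))
    show "(\<one> \<ominus> g) \<otimes> (\<one> \<ominus> g) = \<one> \<ominus> g"
      using gD(1) by (simp add: minus_eq ring_simprules gD(3) r_neg1)
    show "(\<one> \<ominus> g) \<otimes> y = y \<otimes> (\<one> \<ominus> g)" if "y \<in> carrier S" for y
      using gD(1) that by (simp add: minus_eq l_distr r_distr l_minus r_minus gD(4)[OF that])
  qed (use gD(1) in simp)
qed

lemma complement_annihilates_iff:
  assumes "g \<in> carrier S" "y \<in> carrier S"
  shows "(\<one> \<ominus> g) \<otimes> y = \<zero> \<longleftrightarrow> g \<otimes> y = y"
proof -
  have "(\<one> \<ominus> g) \<otimes> y = y \<ominus> g \<otimes> y"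
    using assms by (simp add: minus_eq l_distr l_minus)
  then have "(\<one> \<ominus> g) \<otimes> y = \<zero> \<longleftrightarrow> y = g \<otimes> y" using assms by simp
  then show ?thesis by (rule trans[OF _ eq_commute])
qed

text \<open>
  Testing the annihilator condition on \<open>y = 1 - p\<close> gives \<open>p s = s\<close>; testing it on \<open>y = 1 - g\<close>,
  for a central projection \<open>g\<close> with \<open>g s = s\<close>, gives \<open>p \<le> g\<close>.
\<close>

lemma annihilation_cover_imp_central_cover:
  assumes s: "s \<in> carrier S" and p: "annihilation_cover S star s p"
  shows "is_central_cover S star s p"
proof -
  have pc: "p \<in> central_projections S star"
    and ann: "\<And>y. y \<in> carrier S \<Longrightarrow> (\<forall>t\<in>carrier S. s \<otimes> t \<otimes> y = \<zero>) \<longleftrightarrow> p \<otimes> y = \<zero>"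
    using p by (auto simp: annihilation_cover_def)
  note pD = central_projectionsD[OF pc]
  have "p \<otimes> (\<one> \<ominus> p) = \<zero>"
    using pD(1,3) by (simp add: minus_eq r_distr r_minus r_neg)
  then have "s \<otimes> \<one> \<otimes> (\<one> \<ominus> p) = \<zero>"
    using ann[of "\<one> \<ominus> p"] pD(1) by blast
  then have "(\<one> \<ominus> p) \<otimes> s = \<zero>"
    using s pD(1) central_projectionsD(4)[OF complement_central[OF pc]] by simp
  then have ps: "p \<otimes> s = s"
    using complement_annihilates_iff s pD(1) by simp
  have "p \<otimes> g = p" if g: "g \<in> central_projections S star" and gs: "g \<otimes> s = s" for g
  proof -
    note gD = central_projectionsD[OF g] and qD = central_projectionsD[OF complement_central[OF g]]
    have "s \<otimes> t \<otimes> (\<one> \<ominus> g) = \<zero>" if t: "t \<in> carrier S" for t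
    proof -
      have "s \<otimes> t \<otimes> (\<one> \<ominus> g) = (\<one> \<ominus> g) \<otimes> s \<otimes> t"
        using qD(1) qD(4)[of "s \<otimes> t"] s t by (simp add: m_assoc)
      moreover have "(\<one> \<ominus> g) \<otimes> s = \<zero>"
        using complement_annihilates_iff[OF gD(1) s] gs by simp
      ultimately show ?thesis using t by simp
    qed
    then have "p \<otimes> (\<one> \<ominus> g) = \<zero>" using ann[OF qD(1)] by blast
    then have "(\<one> \<ominus> g) \<otimes> p = \<zero>" using qD(4) pD(1) by simp
    then show ?thesis
      using complement_annihilates_iff[OF gD(1) pD(1)] gD(4)[OF pD(1)] by simp
  qed
  then show ?thesis
    using pc ps by (simp add: is_central_cover_def proj_le_def)
qed

text \<open>\<open>p y = 0\<close> means \<open>y = (1 - p) y\<close>, so the generating projection is \<open>1 - p\<close>.\<close>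

lemma pq_baer_if_annihilation_covers:
  assumes cov: "\<And>s. s \<in> carrier S \<Longrightarrow> \<exists>p. annihilation_cover S star s p"
  shows "pq_baer_star_ring S star"
  unfolding pq_baer_star_ring_def
proof (intro conjI ballI)
  show "star_ring S star" by (rule star_ring_axioms)
next
  fix s assume s: "s \<in> carrier S"
  obtain p where p: "annihilation_cover S star s p" using cov[OF s] by blast
  have pc: "p \<in> central_projections S star"
    and ann: "\<And>y. y \<in> carrier S \<Longrightarrow> (\<forall>t\<in>carrier S. s \<otimes> t \<otimes> y = \<zero>) \<longleftrightarrow> p \<otimes> y = \<zero>"
    using p by (auto simp: annihilation_cover_def)
  note pD = central_projectionsD[OF pc] and qD = central_projectionsD[OF complement_central[OF pc]]
  have eq: "p \<otimes> y = \<zero> \<longleftrightarrow> (\<one> \<ominus> p) \<otimes> y = y" if "y \<in> carrier S" for y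
  proof -
    have "(\<one> \<ominus> p) \<otimes> y = y \<ominus> p \<otimes> y"
      using that pD(1) by (simp add: minus_eq l_distr l_minus)
    then show ?thesis using that pD(1)
      by (simp add: minus_eq add.l_cancel_one)
  qed
  have "right_annihilator S (s <# carrier S) = (\<one> \<ominus> p) <# carrier S"
  proof
    show "right_annihilator S (s <# carrier S) \<subseteq> (\<one> \<ominus> p) <# carrier S"
    proof
      fix y assume "y \<in> right_annihilator S (s <# carrier S)"
      then have y: "y \<in> carrier S" and "\<forall>t\<in>carrier S. s \<otimes> t \<otimes> y = \<zero>"
        by (auto simp: right_annihilator_def l_coset_def)
      then have "(\<one> \<ominus> p) \<otimes> y = y" using ann eq by blast
      then show "y \<in> (\<one> \<ominus> p) <# carrier S"
        using y unfolding l_coset_def by force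
    qed
    show "(\<one> \<ominus> p) <# carrier S \<subseteq> right_annihilator S (s <# carrier S)"
    proof
      fix y assume "y \<in> (\<one> \<ominus> p) <# carrier S"
      then obtain t where t: "t \<in> carrier S" and y: "y = (\<one> \<ominus> p) \<otimes> t"
        by (auto simp: l_coset_def)
      have yc: "y \<in> carrier S" using y t qD(1) by simp
      have "(\<one> \<ominus> p) \<otimes> y = y" using y t qD(1,3) by (simp add: m_assoc[symmetric])
      then have "\<forall>t\<in>carrier S. s \<otimes> t \<otimes> y = \<zero>" using ann[OF yc] eq[OF yc] by blast
      then show "y \<in> right_annihilator S (s <# carrier S)"
        using yc by (auto simp: right_annihilator_def l_coset_def)
    qed
  qed
  moreover have "\<one> \<ominus> p \<in> projections S star"
    using complement_central[OF pc] by (simp add: central_projections_def)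
  ultimately show "\<exists>e\<in>projections S star.
      right_annihilator S (s <# carrier S) = e <# carrier S" by blast
qed

end

section \<open>Faithful unital extensions\<close>

text \<open>
  The properties of the extension that the search for covers uses: \<open>R\<close> sits in \<open>S\<close> as an ideal
  (one side is enough, by the involution), and elements of \<open>S\<close> are determined by their left action
  on \<open>R\<close>.
\<close>

locale faithful_star_extension = R: star_ring R starR + S: unital_star_ring S starS
  for R :: "('a, 'm) ring_scheme" and starR and S :: "('b, 'n) ring_scheme" (structure) and starS +
  fixes \<phi> :: "'a \<Rightarrow> 'b"
  assumes hom: "\<phi> \<in> star_ring_hom R starR S starS"
    and inj: "inj_on \<phi> (carrier R)"
    and ideal: "\<lbrakk> s \<in> carrier S; x \<in> carrier R \<rbrakk> \<Longrightarrow> s \<otimes> \<phi> x \<in> \<phi> ` carrier R"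
    and faithful: "\<lbrakk> s \<in> carrier S; \<And>x. x \<in> carrier R \<Longrightarrow> s \<otimes> \<phi> x = \<zero> \<rbrakk> \<Longrightarrow> s = \<zero>"
begin

lemma phi_closed [simp]: "x \<in> carrier R \<Longrightarrow> \<phi> x \<in> carrier S"
  using hom by (auto simp: star_ring_hom_def)

lemma phi_add: "\<lbrakk> x \<in> carrier R; y \<in> carrier R \<rbrakk> \<Longrightarrow> \<phi> (x \<oplus>\<^bsub>R\<^esub> y) = \<phi> x \<oplus> \<phi> y"
  and phi_mult: "\<lbrakk> x \<in> carrier R; y \<in> carrier R \<rbrakk> \<Longrightarrow> \<phi> (x \<otimes>\<^bsub>R\<^esub> y) = \<phi> x \<otimes> \<phi> y"
  and phi_star: "x \<in> carrier R \<Longrightarrow> \<phi> (starR x) = starS (\<phi> x)"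
  using hom by (auto simp: star_ring_hom_def)

lemma phi_zero [simp]: "\<phi> \<zero>\<^bsub>R\<^esub> = \<zero>"
  using phi_add[of "\<zero>\<^bsub>R\<^esub>" "\<zero>\<^bsub>R\<^esub>"] phi_closed[of "\<zero>\<^bsub>R\<^esub>"] by (simp add: S.add.l_cancel_one)

lemma phi_eq_zero_iff: "x \<in> carrier R \<Longrightarrow> \<phi> x = \<zero> \<longleftrightarrow> x = \<zero>\<^bsub>R\<^esub>"
  using inj by (metis R.zero_closed inj_on_eq_iff phi_zero)

lemma ideal_right:
  assumes s: "s \<in> carrier S" and x: "x \<in> carrier R"
  shows "\<phi> x \<otimes> s \<in> \<phi> ` carrier R"
proof -
  obtain b where b: "b \<in> carrier R" and eq: "starS s \<otimes> \<phi> (starR x) = \<phi> b"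
    using ideal[of "starS s" "starR x"] s x by (auto simp: S.star_closed R.star_closed)
  have "\<phi> x \<otimes> s = starS (starS s \<otimes> \<phi> (starR x))"
    using s x by (simp add: S.star_mult S.star_closed R.star_closed phi_star S.star_star)
  also have "\<dots> = \<phi> (starR b)" using eq phi_star[OF b] by simp
  finally show ?thesis using R.star_closed[OF b] by blast
qed

text \<open>
  A central idempotent of an ideal is central in the whole ring: \<open>s h\<close> and \<open>h s\<close> lie in the
  ideal, so \<open>h\<close> commutes with them, and both are equal to \<open>h s h\<close>.
\<close>

lemma phi_central_projection:
  assumes h: "h \<in> central_projections R starR"
  shows "\<phi> h \<in> central_projections S starS"
proof (rule central_projectionsI)
  note hD = central_projectionsD[OF h]
  show "\<phi> h \<in> carrier S" using hD(1) by simp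
  show "starS (\<phi> h) = \<phi> h" using hD(1,2) phi_star by metis
  show idem: "\<phi> h \<otimes> \<phi> h = \<phi> h" using hD(1,3) phi_mult by metis
  fix s assume s: "s \<in> carrier S"
  obtain b where b: "b \<in> carrier R" and sb: "s \<otimes> \<phi> h = \<phi> b" using ideal[OF s hD(1)] by auto
  obtain c where c: "c \<in> carrier R" and cs: "\<phi> h \<otimes> s = \<phi> c" using ideal_right[OF s hD(1)] by auto
  have "\<phi> h \<otimes> s = \<phi> h \<otimes> \<phi> c"
    using cs[symmetric] s hD(1) by (simp add: S.m_assoc[symmetric] idem)
  also have "\<dots> = \<phi> c \<otimes> \<phi> h" using phi_mult hD(1,4) c by metis
  also have "\<dots> = \<phi> h \<otimes> \<phi> b"
    using cs[symmetric] sb[symmetric] s hD(1) by (simp add: S.m_assoc)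
  also have "\<dots> = \<phi> b \<otimes> \<phi> h" using phi_mult hD(1,4) b by metis
  also have "\<dots> = s \<otimes> \<phi> h"
    using sb[symmetric] s hD(1) by (simp add: S.m_assoc idem)
  finally show "\<phi> h \<otimes> s = s \<otimes> \<phi> h" .
qed

text \<open>
  If \<open>a S y = 0\<close>, then \<open>a R (y x) = 0\<close> with \<open>y x \<in> R\<close> for every \<open>x \<in> R\<close>; hence
  \<open>e y x = 0\<close> for all these \<open>x\<close>, and \<open>e y = 0\<close> by faithfulness.
\<close>

lemma annihilation_cover_lift:
  assumes a: "a \<in> carrier R" and e: "annihilation_cover R starR a e"
    and ea: "e \<otimes>\<^bsub>R\<^esub> a = a"
  shows "annihilation_cover S starS (\<phi> a) (\<phi> e)"
proof -
  have ec: "e \<in> central_projections R starR"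
    and ann: "\<And>y. y \<in> carrier R \<Longrightarrow>
      (\<forall>r\<in>carrier R. a \<otimes>\<^bsub>R\<^esub> r \<otimes>\<^bsub>R\<^esub> y = \<zero>\<^bsub>R\<^esub>) \<longleftrightarrow> e \<otimes>\<^bsub>R\<^esub> y = \<zero>\<^bsub>R\<^esub>"
    using e by (auto simp: annihilation_cover_def)
  note eD = central_projectionsD[OF ec]
  note pc = phi_central_projection[OF ec]
  note pD = central_projectionsD[OF pc]
  have "(\<forall>t\<in>carrier S. \<phi> a \<otimes> t \<otimes> y = \<zero>) \<longleftrightarrow> \<phi> e \<otimes> y = \<zero>" if y: "y \<in> carrier S" for y
  proof
    assume 0: "\<forall>t\<in>carrier S. \<phi> a \<otimes> t \<otimes> y = \<zero>"
    show "\<phi> e \<otimes> y = \<zero>"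
    proof (rule faithful)
      fix x assume x: "x \<in> carrier R"
      obtain z where z: "z \<in> carrier R" and yz: "y \<otimes> \<phi> x = \<phi> z" using ideal[OF y x] by auto
      have "a \<otimes>\<^bsub>R\<^esub> r \<otimes>\<^bsub>R\<^esub> z = \<zero>\<^bsub>R\<^esub>" if r: "r \<in> carrier R" for r
      proof -
        have "\<phi> (a \<otimes>\<^bsub>R\<^esub> r \<otimes>\<^bsub>R\<^esub> z) = \<phi> a \<otimes> \<phi> r \<otimes> (y \<otimes> \<phi> x)"
          using a r z yz by (simp add: phi_mult R.m_closed)
        also have "\<dots> = (\<phi> a \<otimes> \<phi> r \<otimes> y) \<otimes> \<phi> x"
          using a r x y by (simp add: S.m_assoc)
        also have "\<dots> = \<zero>" using 0 r x by simp
        finally show ?thesis using phi_eq_zero_iff a r z by (simp add: R.m_closed)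
      qed
      then have "e \<otimes>\<^bsub>R\<^esub> z = \<zero>\<^bsub>R\<^esub>" using ann[OF z] by blast
      then have "\<phi> e \<otimes> \<phi> z = \<zero>" using phi_mult[OF eD(1) z] by simp
      then show "\<phi> e \<otimes> y \<otimes> \<phi> x = \<zero>" using yz x y pD(1) by (simp add: S.m_assoc)
    qed (use y pD(1) in simp)
  next
    assume 0: "\<phi> e \<otimes> y = \<zero>"
    show "\<forall>t\<in>carrier S. \<phi> a \<otimes> t \<otimes> y = \<zero>"
    proof
      fix t assume t: "t \<in> carrier S"
      have "\<phi> a = \<phi> a \<otimes> \<phi> e" using ea eD(1) eD(4)[OF a] phi_mult[OF a eD(1)] by simp
      then have "\<phi> a \<otimes> t \<otimes> y = \<phi> a \<otimes> \<phi> e \<otimes> t \<otimes> y" by simp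
      also have "\<dots> = \<phi> a \<otimes> t \<otimes> (\<phi> e \<otimes> y)"
        using a t y pD(1) pD(4)[OF t] by (metis S.m_assoc S.m_closed phi_closed)
      also have "\<dots> = \<zero>" using 0 a t by simp
      finally show "\<phi> a \<otimes> t \<otimes> y = \<zero>" .
    qed
  qed
  then show ?thesis using pc by (simp add: annihilation_cover_def)
qed

text \<open>
  The central projection \<open>g\<close> splits \<open>s\<close>. Its part \<open>b = s g\<close> lies in \<open>R\<close> and has a cover
  \<open>e \<le> g\<close> there. The other part kills nothing outside \<open>g\<close>, by the bound on the kernel, so its
  cover is \<open>1 - g\<close>. The sum of the two covers is written as the complement of the projection
  \<open>g - e\<close>, so that the projection property follows from that of a complement. In terms of \<open>y\<close>,
  both sides of the equivalence amount to \<open>g y = y\<close> and \<open>e y = 0\<close>.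
\<close>

lemma annihilation_cover_if_kernel_bounded:
  assumes s: "s \<in> carrier S" and g: "g \<in> central_projections R starR"
    and ker: "\<And>x. \<lbrakk> x \<in> carrier R; s \<otimes> \<phi> x = \<zero> \<rbrakk> \<Longrightarrow> g \<otimes>\<^bsub>R\<^esub> x = x"
    and b: "b \<in> carrier R" "\<phi> b = s \<otimes> \<phi> g"
    and e: "annihilation_cover R starR b e" "is_central_cover R starR b e"
  shows "annihilation_cover S starS s (\<one> \<ominus> (\<phi> g \<ominus> \<phi> e))"
proof -
  note gD = central_projectionsD[OF g]
  note pg = phi_central_projection[OF g]
  note pgD = central_projectionsD[OF pg]
  have ec: "e \<in> central_projections R starR" and eb: "e \<otimes>\<^bsub>R\<^esub> b = b"
    and emin: "\<And>f. f \<in> central_projections R starR \<Longrightarrow> f \<otimes>\<^bsub>R\<^esub> b = b \<Longrightarrow> e \<otimes>\<^bsub>R\<^esub> f = e"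
    using e(2) by (auto simp: is_central_cover_def proj_le_def)
  note eD = central_projectionsD[OF ec]
  note pe = phi_central_projection[OF ec]
  note peD = central_projectionsD[OF pe]
  have bann: "(\<forall>t\<in>carrier S. \<phi> b \<otimes> t \<otimes> y = \<zero>) \<longleftrightarrow> \<phi> e \<otimes> y = \<zero>" if "y \<in> carrier S" for y
    using annihilation_cover_lift[OF b(1) e(1) eb] that by (simp add: annihilation_cover_def)
  \<comment> \<open>Minimality of the central cover \<open>e\<close> gives \<open>e \<le> g\<close>, because \<open>g b = b\<close>.\<close>
  have "\<phi> (g \<otimes>\<^bsub>R\<^esub> b) = \<phi> b"
    using s gD(1) b pgD(1,3,4) by (metis S.m_assoc S.m_closed phi_mult)
  then have "g \<otimes>\<^bsub>R\<^esub> b = b" using inj b(1) gD(1) by (simp add: inj_on_eq_iff R.m_closed)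
  then have "e \<otimes>\<^bsub>R\<^esub> g = e" using emin[OF g] by blast
  then have eg: "\<phi> e \<otimes> \<phi> g = \<phi> e" using phi_mult[OF eD(1) gD(1)] by simp
  then have ge: "\<phi> g \<otimes> \<phi> e = \<phi> e" using peD(4)[OF pgD(1)] by simp
  define d where "d = \<phi> g \<ominus> \<phi> e"
  have dc: "d \<in> carrier S" using pgD(1) peD(1) by (simp add: d_def)
  have d: "d \<in> central_projections S starS"
  proof (rule central_projectionsI[OF dc])
    show "starS d = d" using pgD(1) peD(1)
      by (simp add: d_def S.minus_eq S.star_add S.star_minus pgD(2) peD(2))
    have gd: "\<phi> g \<otimes> d = d" using pgD(1) peD(1)
      by (simp add: d_def S.minus_eq S.r_distr S.r_minus pgD(3) ge)
    have ed: "\<phi> e \<otimes> d = \<zero>" using pgD(1) peD(1)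
      by (simp add: d_def S.minus_eq S.r_distr S.r_minus peD(3) eg S.r_neg)
    have "d \<otimes> d = \<phi> g \<otimes> d \<ominus> \<phi> e \<otimes> d" using pgD(1) peD(1) dc
      by (subst (1) d_def) (simp add: S.minus_eq S.l_distr S.l_minus)
    then show "d \<otimes> d = d" using gd ed dc by (simp add: S.minus_eq)
    show "d \<otimes> y = y \<otimes> d" if "y \<in> carrier S" for y
      using pgD(1) peD(1) that
      by (simp add: d_def S.minus_eq S.l_distr S.r_distr S.l_minus S.r_minus pgD(4)[OF that] peD(4)[OF that])
  qed
  have "(\<forall>t\<in>carrier S. s \<otimes> t \<otimes> y = \<zero>) \<longleftrightarrow> (\<one> \<ominus> d) \<otimes> y = \<zero>" if y: "y \<in> carrier S" for y
  proof -
    have dy: "d \<otimes> y = \<phi> g \<otimes> y \<ominus> \<phi> e \<otimes> y"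
      using y pgD(1) peD(1) by (simp add: d_def S.minus_eq S.l_distr S.l_minus)
    have "(\<forall>t\<in>carrier S. s \<otimes> t \<otimes> y = \<zero>) \<longleftrightarrow> \<phi> g \<otimes> y = y \<and> \<phi> e \<otimes> y = \<zero>"
    proof (intro iffI conjI)
      assume 0: "\<forall>t\<in>carrier S. s \<otimes> t \<otimes> y = \<zero>"
      \<comment> \<open>Already \<open>s 1 y = 0\<close> puts every \<open>y x\<close> into the kernel of \<open>s\<close>.\<close>
      have "(\<one> \<ominus> \<phi> g) \<otimes> y = \<zero>"
      proof (rule faithful)
        fix x assume x: "x \<in> carrier R"
        obtain z where z: "z \<in> carrier R" and yz: "y \<otimes> \<phi> x = \<phi> z" using ideal[OF y x] by auto
        have "s \<otimes> \<phi> z = (s \<otimes> \<one> \<otimes> y) \<otimes> \<phi> x"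
          using yz[symmetric] s x y by (simp add: S.m_assoc)
        also have "\<dots> = \<zero>" using 0 x by (metis S.l_zero_mult S.one_closed phi_closed)
        finally have "\<phi> g \<otimes> \<phi> z = \<phi> z" using ker[OF z] phi_mult[OF gD(1) z] by simp
        then show "(\<one> \<ominus> \<phi> g) \<otimes> y \<otimes> \<phi> x = \<zero>"
          using S.complement_annihilates_iff[OF pgD(1) phi_closed[OF z]] yz x y pgD(1)
          by (simp add: S.m_assoc)
      qed (use y pgD(1) in simp)
      then show "\<phi> g \<otimes> y = y" using S.complement_annihilates_iff[OF pgD(1) y] by simp
      have "\<phi> b \<otimes> t \<otimes> y = \<zero>" if t: "t \<in> carrier S" for t
        using 0[rule_format, of "\<phi> g \<otimes> t"] s t y pgD(1) b(2) by (simp add: S.m_assoc)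
      then show "\<phi> e \<otimes> y = \<zero>" using bann[OF y] by blast
    next
      assume A: "\<phi> g \<otimes> y = y \<and> \<phi> e \<otimes> y = \<zero>"
      show "\<forall>t\<in>carrier S. s \<otimes> t \<otimes> y = \<zero>"
      proof
        fix t assume t: "t \<in> carrier S"
        have "s \<otimes> t \<otimes> y = s \<otimes> t \<otimes> (\<phi> g \<otimes> y)" using A by simp
        also have "\<dots> = \<phi> b \<otimes> t \<otimes> y"
          using s t y pgD(1) pgD(4)[OF t] b(2) by (metis S.m_assoc S.m_closed)
        also have "\<dots> = \<zero>" using bann[OF y] A t by blast
        finally show "s \<otimes> t \<otimes> y = \<zero>" .
      qed
    qed
    also have "\<dots> \<longleftrightarrow> d \<otimes> y = y"
    proof
      assume "\<phi> g \<otimes> y = y \<and> \<phi> e \<otimes> y = \<zero>"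
      then show "d \<otimes> y = y" using dy y by (simp add: S.minus_eq)
    next
      assume 1: "d \<otimes> y = y"
      have "\<phi> e \<otimes> (d \<otimes> y) = \<phi> e \<otimes> y \<ominus> \<phi> e \<otimes> y"
        using y pgD(1) peD(1) unfolding dy
        by (simp add: S.minus_eq S.r_distr S.r_minus S.m_assoc[symmetric] peD(3) eg)
      then have e0: "\<phi> e \<otimes> y = \<zero>" using 1 y peD(1) by (simp add: S.minus_eq S.r_neg)
      then show "\<phi> g \<otimes> y = y \<and> \<phi> e \<otimes> y = \<zero>"
        using 1 dy y pgD(1) by (simp add: S.minus_eq)
    qed
    also have "\<dots> \<longleftrightarrow> (\<one> \<ominus> d) \<otimes> y = \<zero>" using S.complement_annihilates_iff[OF dc y] by simp
    finally show ?thesis .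
  qed
  then show ?thesis
    using S.complement_central[OF d] by (simp add: annihilation_cover_def d_def)
qed

end

section \<open>Quotients of unital star rings\<close>

lemma (in ideal) star_image_coset:
  assumes star: "star_ring R star" and N: "\<And>n. n \<in> I \<Longrightarrow> star n \<in> I" and x: "x \<in> carrier R"
  shows "star ` (I +> x) = I +> star x"
proof -
  interpret star_ring R star by (rule star)
  have car: "n \<in> carrier R" if "n \<in> I" for n using that by (rule a_Hcarr)
  have "star (n \<oplus> x) \<in> I +> star x" if "n \<in> I" for n
    using that N car x unfolding a_r_coset_def' by (auto simp: star_add)
  moreover have "n \<oplus> star x \<in> star ` (I +> x)" if n: "n \<in> I" for n
  proof (rule image_eqI)
    show "n \<oplus> star x = star (star n \<oplus> x)"
      using car[OF n] x by (simp add: star_add star_closed star_star)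
    show "star n \<oplus> x \<in> I +> x" using N[OF n] unfolding a_r_coset_def' by blast
  qed
  ultimately show ?thesis unfolding a_r_coset_def' by auto
qed

lemma carrier_FactRing: "carrier (R Quot I) = (\<lambda>x. I +>\<^bsub>R\<^esub> x) ` carrier R"
  by (auto simp: FactRing_simps)

lemma (in ideal) quotient_unital_star_ring:
  assumes star: "star_ring R star" and N: "\<And>n. n \<in> I \<Longrightarrow> star n \<in> I"
  shows "unital_star_ring (R Quot I) (\<lambda>X. star ` X)"
proof -
  interpret S: star_ring R star by (rule star)
  interpret Q: ring "R Quot I" by (rule quotient_is_ring)
  note img = star_image_coset[OF star N]
  show ?thesis
  proof (intro unital_star_ring.intro star_ring.intro star_ring_axioms.intro)
    show "ring (R Quot I)" by (rule Q.ring_axioms)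
    show "abelian_group (R Quot I)" by (rule Q.abelian_group_axioms)
    show "star ` X \<in> carrier (R Quot I)" if "X \<in> carrier (R Quot I)" for X
      using that by (auto simp: carrier_FactRing img S.star_closed)
    show "star ` (X \<oplus>\<^bsub>R Quot I\<^esub> Y) = star ` X \<oplus>\<^bsub>R Quot I\<^esub> star ` Y"
      if X: "X \<in> carrier (R Quot I)" and Y: "Y \<in> carrier (R Quot I)" for X Y
    proof -
      obtain x y where "x \<in> carrier R" "X = I +> x" "y \<in> carrier R" "Y = I +> y"
        using X Y by (auto simp: carrier_FactRing)
      then show ?thesis
        by (simp add: FactRing_def img S.star_closed a_rcos_sum S.star_add)
    qed
    show "star ` (X \<otimes>\<^bsub>R Quot I\<^esub> Y) = star ` Y \<otimes>\<^bsub>R Quot I\<^esub> star ` X"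
      if X: "X \<in> carrier (R Quot I)" and Y: "Y \<in> carrier (R Quot I)" for X Y
    proof -
      obtain x y where "x \<in> carrier R" "X = I +> x" "y \<in> carrier R" "Y = I +> y"
        using X Y by (auto simp: carrier_FactRing)
      then show ?thesis
        by (simp add: FactRing_def img S.star_closed rcoset_mult_add S.star_mult)
    qed
    show "star ` star ` X = X" if X: "X \<in> carrier (R Quot I)" for X
    proof -
      obtain x where "x \<in> carrier R" "X = I +> x" using X by (auto simp: carrier_FactRing)
      then show ?thesis by (simp add: img S.star_closed S.star_star)
    qed
  qed (auto simp: Q.m_assoc Q.l_distr Q.r_distr)
qed

section \<open>The unitization of an algebra and its reduction\<close>

context star_algebra
begin

text \<open>A pair \<open>(a, l)\<close> stands for the formal sum \<open>a + l\<close> of a ring element and a scalar.\<close>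

definition unitization :: "('c \<times> 'a) ring"
  where "unitization =
    \<lparr>carrier = carrier R \<times> carrier K,
     mult = (\<lambda>(a, l) (b, m). (a \<otimes>\<^bsub>R\<^esub> b \<oplus>\<^bsub>R\<^esub> l \<odot>\<^bsub>R\<^esub> b \<oplus>\<^bsub>R\<^esub> m \<odot>\<^bsub>R\<^esub> a, l \<otimes> m)),
     one = (\<zero>\<^bsub>R\<^esub>, \<one>),
     zero = (\<zero>\<^bsub>R\<^esub>, \<zero>),
     add = (\<lambda>(a, l) (b, m). (a \<oplus>\<^bsub>R\<^esub> b, l \<oplus> m))\<rparr>"

definition star_unitization :: "'c \<times> 'a \<Rightarrow> 'c \<times> 'a"
  where "star_unitization = map_prod starR starK"

definition left_action :: "'c \<times> 'a \<Rightarrow> 'c \<Rightarrow> 'c"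
  where "left_action s x = fst s \<otimes>\<^bsub>R\<^esub> x \<oplus>\<^bsub>R\<^esub> snd s \<odot>\<^bsub>R\<^esub> x"

definition action_kernel :: "('c \<times> 'a) set"
  where "action_kernel =
    {s \<in> carrier unitization. \<forall>x\<in>carrier R. left_action s x = \<zero>\<^bsub>R\<^esub>}"

lemma unitization_simps [simp]:
  "carrier unitization = carrier R \<times> carrier K"
  "(a, l) \<otimes>\<^bsub>unitization\<^esub> (b, m) =
    (a \<otimes>\<^bsub>R\<^esub> b \<oplus>\<^bsub>R\<^esub> l \<odot>\<^bsub>R\<^esub> b \<oplus>\<^bsub>R\<^esub> m \<odot>\<^bsub>R\<^esub> a, l \<otimes> m)"
  "(a, l) \<oplus>\<^bsub>unitization\<^esub> (b, m) = (a \<oplus>\<^bsub>R\<^esub> b, l \<oplus> m)"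
  "\<one>\<^bsub>unitization\<^esub> = (\<zero>\<^bsub>R\<^esub>, \<one>)"
  "\<zero>\<^bsub>unitization\<^esub> = (\<zero>\<^bsub>R\<^esub>, \<zero>)"
  by (simp_all add: unitization_def)

lemma mult_smult:
  "\<lbrakk> l \<in> carrier K; a \<in> carrier R; b \<in> carrier R \<rbrakk>
    \<Longrightarrow> a \<otimes>\<^bsub>R\<^esub> (l \<odot>\<^bsub>R\<^esub> b) = l \<odot>\<^bsub>R\<^esub> (a \<otimes>\<^bsub>R\<^esub> b)"
  using smult_assoc_left smult_assoc_right by metis

lemma smult_left_comm:
  "\<lbrakk> l \<in> carrier K; m \<in> carrier K; a \<in> carrier R \<rbrakk>
    \<Longrightarrow> l \<odot>\<^bsub>R\<^esub> (m \<odot>\<^bsub>R\<^esub> a) = m \<odot>\<^bsub>R\<^esub> (l \<odot>\<^bsub>R\<^esub> a)"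
  by (metis smult_assoc1 m_comm)

lemmas algebra_normalize =
  R.m_closed R.l_distr R.r_distr R.m_assoc smult_l_distr smult_r_distr smult_assoc1
  smult_assoc_left[symmetric] mult_smult smult_left_comm M.a_assoc M.a_comm M.a_lcomm

lemma ring_unitization: "ring unitization"
proof (rule ringI)
  show "abelian_group unitization"
  proof (rule abelian_groupI)
    show "\<exists>t\<in>carrier unitization. t \<oplus>\<^bsub>unitization\<^esub> s = \<zero>\<^bsub>unitization\<^esub>"
      if s: "s \<in> carrier unitization" for s
    proof
      show "(\<ominus>\<^bsub>R\<^esub> fst s, \<ominus> snd s) \<oplus>\<^bsub>unitization\<^esub> s = \<zero>\<^bsub>unitization\<^esub>"
        using s by (cases s) (simp add: M.l_neg R.l_neg)
    qed (use s in \<open>auto simp: mem_Times_iff\<close>)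
  qed (auto simp: M.a_ac R.a_ac)
  show "Group.monoid unitization"
    by (rule monoidI) (auto simp: algebra_normalize K.m_closed K.m_assoc)
qed (auto simp: algebra_normalize K.l_distr K.r_distr)

lemma star_ring_unitization: "star_ring unitization star_unitization"
proof -
  interpret U: ring unitization by (rule ring_unitization)
  show ?thesis
  proof (intro star_ring.intro star_ring_axioms.intro)
    show "abelian_group unitization" by (rule U.abelian_group_axioms)
  next
    show "s \<otimes>\<^bsub>unitization\<^esub> t \<in> carrier unitization"
      if "s \<in> carrier unitization" "t \<in> carrier unitization" for s t
      using that by (rule U.m_closed)
  next
    fix s t assume "s \<in> carrier unitization" "t \<in> carrier unitization"
    then show "star_unitization (s \<otimes>\<^bsub>unitization\<^esub> t) =
        star_unitization t \<otimes>\<^bsub>unitization\<^esub> star_unitization s"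
      by (auto simp: star_unitization_def R.star_add R.star_mult K.star_mult star_smult
          R.m_closed R.star_closed K.star_closed M.a_ac)
  qed (auto simp: star_unitization_def R.star_add K.star_add R.star_closed K.star_closed
      R.star_star K.star_star U.m_assoc U.l_distr U.r_distr simp del: unitization_simps(2))
qed

lemma left_action_closed [simp]:
  "\<lbrakk> s \<in> carrier unitization; x \<in> carrier R \<rbrakk> \<Longrightarrow> left_action s x \<in> carrier R"
  by (auto simp: left_action_def R.m_closed)

lemma left_action_zero: "s \<in> carrier unitization \<Longrightarrow> left_action s \<zero>\<^bsub>R\<^esub> = \<zero>\<^bsub>R\<^esub>"
  by (auto simp: left_action_def)

lemma left_action_add:
  "\<lbrakk> s \<in> carrier unitization; t \<in> carrier unitization; x \<in> carrier R \<rbrakk>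
    \<Longrightarrow> left_action (s \<oplus>\<^bsub>unitization\<^esub> t) x = left_action s x \<oplus>\<^bsub>R\<^esub> left_action t x"
  by (auto simp: left_action_def algebra_normalize)

lemma left_action_mult:
  "\<lbrakk> s \<in> carrier unitization; t \<in> carrier unitization; x \<in> carrier R \<rbrakk>
    \<Longrightarrow> left_action (s \<otimes>\<^bsub>unitization\<^esub> t) x = left_action s (left_action t x)"
  by (auto simp: left_action_def algebra_normalize)

lemma ideal_action_kernel: "ideal action_kernel unitization"
proof -
  interpret U: ring unitization by (rule ring_unitization)
  note [simp del] = unitization_simps
  show ?thesis
  proof (rule idealI[OF ring_unitization])
    show "subgroup action_kernel (add_monoid unitization)"
    proof (rule U.add.subgroupI)
      show "action_kernel \<noteq> {}"
      proof -
        have "\<zero>\<^bsub>unitization\<^esub> \<in> action_kernel"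
          by (auto simp: action_kernel_def unitization_simps left_action_def)
        then show ?thesis by blast
      qed
    next
      fix s assume s: "s \<in> action_kernel"
      have "left_action (\<ominus>\<^bsub>unitization\<^esub> s) x = \<zero>\<^bsub>R\<^esub>" if x: "x \<in> carrier R" for x
      proof -
        have "left_action (\<ominus>\<^bsub>unitization\<^esub> s \<oplus>\<^bsub>unitization\<^esub> s) x = \<zero>\<^bsub>R\<^esub>"
          using s x by (simp add: action_kernel_def U.l_neg) (simp add: unitization_simps left_action_def)
        then show ?thesis using s x by (simp add: left_action_add action_kernel_def)
      qed
      then show "\<ominus>\<^bsub>unitization\<^esub> s \<in> action_kernel"
        using s by (simp add: action_kernel_def)
    qed (auto simp: action_kernel_def left_action_add)
  qed (auto simp: action_kernel_def left_action_mult left_action_zero)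
qed

text \<open>
  The kernel is defined by an action from the left, and the involution turns it into the kernel of
  the action from the right. For \<open>n\<close> in the kernel, \<open>y (n\<^sup>* z) = (n y\<^sup>*)\<^sup>* z = 0\<close> for all \<open>y\<close>, so
  \<open>n\<^sup>* z = 0\<close> as soon as \<open>R\<close> contains no nonzero element that it annihilates from the left.
\<close>

lemma star_action_kernel:
  assumes right_faithful: "\<And>x. \<lbrakk> x \<in> carrier R; \<And>y. y \<in> carrier R \<Longrightarrow> y \<otimes>\<^bsub>R\<^esub> x = \<zero>\<^bsub>R\<^esub> \<rbrakk>
      \<Longrightarrow> x = \<zero>\<^bsub>R\<^esub>"
    and n: "n \<in> action_kernel"
  shows "star_unitization n \<in> action_kernel"
proof -
  obtain a l where n_eq: "n = (a, l)" and a: "a \<in> carrier R" and l: "l \<in> carrier K"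
    using n by (auto simp: action_kernel_def)
  have 0: "a \<otimes>\<^bsub>R\<^esub> x \<oplus>\<^bsub>R\<^esub> l \<odot>\<^bsub>R\<^esub> x = \<zero>\<^bsub>R\<^esub>" if "x \<in> carrier R" for x
    using n that by (simp add: action_kernel_def n_eq left_action_def)
  have "starR a \<otimes>\<^bsub>R\<^esub> z \<oplus>\<^bsub>R\<^esub> starK l \<odot>\<^bsub>R\<^esub> z = \<zero>\<^bsub>R\<^esub>" if z: "z \<in> carrier R" for z
  proof (rule right_faithful)
    show "starR a \<otimes>\<^bsub>R\<^esub> z \<oplus>\<^bsub>R\<^esub> starK l \<odot>\<^bsub>R\<^esub> z \<in> carrier R"
      using a l z by (simp add: R.m_closed R.star_closed K.star_closed)
    fix y assume y: "y \<in> carrier R"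
    have "y \<otimes>\<^bsub>R\<^esub> (starR a \<otimes>\<^bsub>R\<^esub> z \<oplus>\<^bsub>R\<^esub> starK l \<odot>\<^bsub>R\<^esub> z)
        = (y \<otimes>\<^bsub>R\<^esub> starR a \<oplus>\<^bsub>R\<^esub> starK l \<odot>\<^bsub>R\<^esub> y) \<otimes>\<^bsub>R\<^esub> z"
      using a l y z by (simp add: algebra_normalize R.star_closed K.star_closed)
    also have "y \<otimes>\<^bsub>R\<^esub> starR a \<oplus>\<^bsub>R\<^esub> starK l \<odot>\<^bsub>R\<^esub> y
        = starR (a \<otimes>\<^bsub>R\<^esub> starR y \<oplus>\<^bsub>R\<^esub> l \<odot>\<^bsub>R\<^esub> starR y)"
      using a l y by (simp add: R.star_add R.star_mult star_smult R.star_closed R.star_star R.m_closed)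
    also have "\<dots> = \<zero>\<^bsub>R\<^esub>" using 0[OF R.star_closed[OF y]] by simp
    finally show "y \<otimes>\<^bsub>R\<^esub> (starR a \<otimes>\<^bsub>R\<^esub> z \<oplus>\<^bsub>R\<^esub> starK l \<odot>\<^bsub>R\<^esub> z) = \<zero>\<^bsub>R\<^esub>"
      using z by simp
  qed
  then show ?thesis
    using a l by (simp add: action_kernel_def n_eq star_unitization_def left_action_def
        R.star_closed K.star_closed)
qed

definition reduced_unitization :: "('c \<times> 'a) set ring"
  where "reduced_unitization = unitization Quot action_kernel"

lemma carrier_reduced_unitization:
  "carrier reduced_unitization = (\<lambda>s. action_kernel +>\<^bsub>unitization\<^esub> s) ` carrier unitization"
  by (simp only: reduced_unitization_def carrier_FactRing)

definition embedding :: "'c \<Rightarrow> ('c \<times> 'a) set"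
  where "embedding x = action_kernel +>\<^bsub>unitization\<^esub> (x, \<zero>)"

text \<open>
  Inside the quotient, the action on \<open>R\<close> is multiplication with embedded elements. This makes
  \<open>R\<close> an ideal, and it makes the action of the quotient faithful, since its kernel was divided out.
\<close>

lemma coset_mult_embedding:
  assumes s: "s \<in> carrier unitization" and x: "x \<in> carrier R"
  shows "(action_kernel +>\<^bsub>unitization\<^esub> s) \<otimes>\<^bsub>reduced_unitization\<^esub> embedding x
    = embedding (left_action s x)"
proof -
  interpret N: ideal action_kernel unitization by (rule ideal_action_kernel)
  have "s \<otimes>\<^bsub>unitization\<^esub> (x, \<zero>) = (left_action s x, \<zero>)"
    using s x by (cases s) (simp add: left_action_def R.m_closed smult_l_null)
  then show ?thesis
    using s x by (simp add: reduced_unitization_def FactRing_def embedding_def N.rcoset_mult_add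
        del: unitization_simps(2))
qed

lemma faithful_star_extension_embedding:
  assumes left_faithful: "\<And>x. \<lbrakk> x \<in> carrier R; \<And>y. y \<in> carrier R \<Longrightarrow> x \<otimes>\<^bsub>R\<^esub> y = \<zero>\<^bsub>R\<^esub> \<rbrakk>
      \<Longrightarrow> x = \<zero>\<^bsub>R\<^esub>"
    and right_faithful: "\<And>x. \<lbrakk> x \<in> carrier R; \<And>y. y \<in> carrier R \<Longrightarrow> y \<otimes>\<^bsub>R\<^esub> x = \<zero>\<^bsub>R\<^esub> \<rbrakk>
      \<Longrightarrow> x = \<zero>\<^bsub>R\<^esub>"
  shows "faithful_star_extension R starR reduced_unitization (\<lambda>X. star_unitization ` X) embedding"
proof -
  interpret N: ideal action_kernel unitization by (rule ideal_action_kernel)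
  interpret Q: unital_star_ring reduced_unitization "\<lambda>X. star_unitization ` X"
    unfolding reduced_unitization_def
    by (rule N.quotient_unital_star_ring[OF star_ring_unitization star_action_kernel[OF right_faithful]])
  have closed: "embedding x \<in> carrier reduced_unitization" if "x \<in> carrier R" for x
    using that by (auto simp: embedding_def carrier_reduced_unitization)
  have add: "embedding (x \<oplus>\<^bsub>R\<^esub> y) = embedding x \<oplus>\<^bsub>reduced_unitization\<^esub> embedding y"
    if "x \<in> carrier R" "y \<in> carrier R" for x y
    using that by (simp add: embedding_def reduced_unitization_def FactRing_def N.a_rcos_sum)
  have mult: "embedding (x \<otimes>\<^bsub>R\<^esub> y) = embedding x \<otimes>\<^bsub>reduced_unitization\<^esub> embedding y"
    if "x \<in> carrier R" "y \<in> carrier R" for x y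
    using coset_mult_embedding[of "(x, \<zero>)" y] that
    by (simp add: left_action_def embedding_def[of x] R.m_closed)
  have star: "embedding (starR x) = star_unitization ` embedding x" if "x \<in> carrier R" for x
    using that N.star_image_coset[OF star_ring_unitization star_action_kernel[OF right_faithful], of "(x, \<zero>)"]
    by (simp add: embedding_def star_unitization_def)
  have inj: "inj_on embedding (carrier R)"
  proof (rule inj_onI)
    fix x y assume x: "x \<in> carrier R" and y: "y \<in> carrier R" and eq: "embedding x = embedding y"
    have "(x, \<zero>) \<in> embedding y"
      using N.a_rcos_self[of "(x, \<zero>)"] x eq by (simp add: embedding_def)
    then obtain n where n: "n \<in> action_kernel" and xn: "(x, \<zero>) = n \<oplus>\<^bsub>unitization\<^esub> (y, \<zero>)"
      by (auto simp: embedding_def a_r_coset_def')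
    obtain d k where n_eq: "n = (d, k)" and d: "d \<in> carrier R" and k: "k \<in> carrier K"
      using n by (auto simp: action_kernel_def)
    have xd: "x = d \<oplus>\<^bsub>R\<^esub> y" and k0: "k = \<zero>" using xn k by (simp_all add: n_eq)
    have "d \<otimes>\<^bsub>R\<^esub> z = \<zero>\<^bsub>R\<^esub>" if "z \<in> carrier R" for z
      using n that d by (simp add: n_eq k0 action_kernel_def left_action_def R.m_closed)
    then have "d = \<zero>\<^bsub>R\<^esub>" by (rule left_faithful[OF d])
    then show "x = y" using xd y by simp
  qed
  have zero: "embedding \<zero>\<^bsub>R\<^esub> = \<zero>\<^bsub>reduced_unitization\<^esub>"
    using N.a_rcos_const[OF additive_subgroup.zero_closed[OF N.additive_subgroup_axioms]]
    by (simp add: embedding_def reduced_unitization_def FactRing_def)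
  show ?thesis
  proof (intro faithful_star_extension.intro faithful_star_extension_axioms.intro)
    show "star_ring R starR" by (rule R.star_ring_axioms)
    show "unital_star_ring reduced_unitization (\<lambda>X. star_unitization ` X)"
      by (rule Q.unital_star_ring_axioms)
    show "embedding \<in> star_ring_hom R starR reduced_unitization (\<lambda>X. star_unitization ` X)"
      by (simp add: star_ring_hom_def closed add mult star)
    show "inj_on embedding (carrier R)" by (rule inj)
  next
    fix X x assume X: "X \<in> carrier reduced_unitization" and x: "x \<in> carrier R"
    obtain s where s: "s \<in> carrier unitization" and Xs: "X = action_kernel +>\<^bsub>unitization\<^esub> s"
      using X by (auto simp: carrier_reduced_unitization)
    show "X \<otimes>\<^bsub>reduced_unitization\<^esub> embedding x \<in> embedding ` carrier R"
      using coset_mult_embedding[OF s x] left_action_closed[OF s x] by (simp add: Xs)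
  next
    fix X assume X: "X \<in> carrier reduced_unitization"
      and X0: "\<And>x. x \<in> carrier R
        \<Longrightarrow> X \<otimes>\<^bsub>reduced_unitization\<^esub> embedding x = \<zero>\<^bsub>reduced_unitization\<^esub>"
    obtain s where s: "s \<in> carrier unitization" and Xs: "X = action_kernel +>\<^bsub>unitization\<^esub> s"
      using X by (auto simp: carrier_reduced_unitization)
    have "left_action s x = \<zero>\<^bsub>R\<^esub>" if x: "x \<in> carrier R" for x
    proof -
      have "embedding (left_action s x) = embedding \<zero>\<^bsub>R\<^esub>"
        using X0[OF x] coset_mult_embedding[OF s x] by (simp add: Xs zero)
      then show ?thesis
        by (rule inj_onD[OF inj _ left_action_closed[OF s x] M.zero_closed])
    qed
    then have "s \<in> action_kernel" using s by (simp add: action_kernel_def)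
    then show "X = \<zero>\<^bsub>reduced_unitization\<^esub>"
      using N.a_rcos_const by (simp add: Xs reduced_unitization_def FactRing_def)
  qed
qed

end

section \<open>Weakly p.q.-Baer algebras\<close>

lemma weakly_pq_baer_central_cover:
  assumes "weakly_pq_baer_star_ring R star" "x \<in> carrier R"
  shows "is_central_cover R star x (central_cover R star x)"
    and "annihilation_cover R star x (central_cover R star x)"
proof -
  obtain e where e: "is_central_cover R star x e"
    and ann: "\<forall>y\<in>carrier R.
        (\<forall>r\<in>carrier R. x \<otimes>\<^bsub>R\<^esub> r \<otimes>\<^bsub>R\<^esub> y = \<zero>\<^bsub>R\<^esub>) \<longleftrightarrow> e \<otimes>\<^bsub>R\<^esub> y = \<zero>\<^bsub>R\<^esub>"
    using assms unfolding weakly_pq_baer_star_ring_def by blast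
  have "e \<in> central_projections R star" using e by (simp add: is_central_cover_def)
  then have "annihilation_cover R star x e" using ann by (simp add: annihilation_cover_def)
  then show "is_central_cover R star x (central_cover R star x)"
    and "annihilation_cover R star x (central_cover R star x)"
    using e central_cover_eq[OF e] by simp_all
qed

text \<open>Multiplying \<open>x\<close> by its own central cover, on either side, gives \<open>x\<close> back.\<close>

lemma weakly_pq_baer_faithful:
  assumes R: "weakly_pq_baer_star_ring R star" and x: "x \<in> carrier R"
  shows "(\<And>y. y \<in> carrier R \<Longrightarrow> x \<otimes>\<^bsub>R\<^esub> y = \<zero>\<^bsub>R\<^esub>) \<Longrightarrow> x = \<zero>\<^bsub>R\<^esub>"
    and "(\<And>y. y \<in> carrier R \<Longrightarrow> y \<otimes>\<^bsub>R\<^esub> x = \<zero>\<^bsub>R\<^esub>) \<Longrightarrow> x = \<zero>\<^bsub>R\<^esub>"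
proof -
  have "central_cover R star x \<in> central_projections R star"
    and cx: "central_cover R star x \<otimes>\<^bsub>R\<^esub> x = x"
    using weakly_pq_baer_central_cover(1)[OF R x] by (auto simp: is_central_cover_def)
  note cD = central_projectionsD[OF this(1)]
  show "x = \<zero>\<^bsub>R\<^esub>" if "\<And>y. y \<in> carrier R \<Longrightarrow> x \<otimes>\<^bsub>R\<^esub> y = \<zero>\<^bsub>R\<^esub>"
    using that[OF cD(1)] cD(4)[OF x] cx by simp
  show "x = \<zero>\<^bsub>R\<^esub>" if "\<And>y. y \<in> carrier R \<Longrightarrow> y \<otimes>\<^bsub>R\<^esub> x = \<zero>\<^bsub>R\<^esub>"
    using that[OF cD(1)] cx by simp
qed

text \<open>
  Let \<open>g\<close> be above \<open>C(a)\<close> and \<open>C(e)\<close>. If \<open>a x + l x = 0\<close>, then \<open>l x = - a x\<close> is fixed by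
  \<open>g\<close>, so \<open>z = x - g x\<close> is a torsion element: \<open>l z = 0\<close>. Hence \<open>z = C(z) z = C(z) e z\<close>, which
  is zero because \<open>e z = e C(e) z\<close> and \<open>C(e) z = 0\<close>.
\<close>

lemma (in star_algebra) left_action_kernel_bounded:
  assumes W: "weakly_pq_baer_star_ring R starR"
    and a: "a \<in> carrier R" and l: "l \<in> carrier K"
    and e: "e \<in> projections R starR"
    and tor: "\<And>x. \<lbrakk> x \<in> carrier R; l \<odot>\<^bsub>R\<^esub> x = \<zero>\<^bsub>R\<^esub> \<rbrakk> \<Longrightarrow> proj_le R (central_cover R starR x) e"
  obtains g where "g \<in> central_projections R starR"
    "\<And>x. \<lbrakk> x \<in> carrier R; left_action (a, l) x = \<zero>\<^bsub>R\<^esub> \<rbrakk> \<Longrightarrow> g \<otimes>\<^bsub>R\<^esub> x = x"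
proof -
  have ec: "e \<in> carrier R" using e by (simp add: projections_def)
  define h where "h = central_cover R starR e"
  define k where "k = central_cover R starR a"
  have h: "h \<in> central_projections R starR" and he: "h \<otimes>\<^bsub>R\<^esub> e = e"
    using weakly_pq_baer_central_cover(1)[OF W ec] by (auto simp: is_central_cover_def h_def)
  have k: "k \<in> central_projections R starR" and ka: "k \<otimes>\<^bsub>R\<^esub> a = a"
    using weakly_pq_baer_central_cover(1)[OF W a] by (auto simp: is_central_cover_def k_def)
  obtain g where g: "g \<in> central_projections R starR"
    and hg: "h \<otimes>\<^bsub>R\<^esub> g = h" and kg: "k \<otimes>\<^bsub>R\<^esub> g = k"
    using R.central_projections_join[OF h k] by blast
  note hD = central_projectionsD[OF h] and kD = central_projectionsD[OF k]
    and gD = central_projectionsD[OF g]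
  have ga: "g \<otimes>\<^bsub>R\<^esub> a = a"
    by (metis R.m_assoc a gD(1) gD(4) kD(1) ka kg)
  have "g \<otimes>\<^bsub>R\<^esub> x = x" if x: "x \<in> carrier R" and x0: "left_action (a, l) x = \<zero>\<^bsub>R\<^esub>" for x
  proof -
    have lx: "l \<odot>\<^bsub>R\<^esub> x \<in> carrier R" and ax: "a \<otimes>\<^bsub>R\<^esub> x \<in> carrier R"
      using a l x by (simp_all add: R.m_closed)
    have x1: "a \<otimes>\<^bsub>R\<^esub> x \<oplus>\<^bsub>R\<^esub> l \<odot>\<^bsub>R\<^esub> x = \<zero>\<^bsub>R\<^esub>"
      using x0 by (simp add: left_action_def)
    have "g \<otimes>\<^bsub>R\<^esub> (a \<otimes>\<^bsub>R\<^esub> x) = a \<otimes>\<^bsub>R\<^esub> x"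
      using a x gD(1) ga by (simp add: R.m_assoc[symmetric])
    then have "a \<otimes>\<^bsub>R\<^esub> x \<oplus>\<^bsub>R\<^esub> g \<otimes>\<^bsub>R\<^esub> (l \<odot>\<^bsub>R\<^esub> x) = g \<otimes>\<^bsub>R\<^esub> (a \<otimes>\<^bsub>R\<^esub> x \<oplus>\<^bsub>R\<^esub> l \<odot>\<^bsub>R\<^esub> x)"
      using ax lx gD(1) by (simp add: R.r_distr)
    also have "\<dots> = a \<otimes>\<^bsub>R\<^esub> x \<oplus>\<^bsub>R\<^esub> l \<odot>\<^bsub>R\<^esub> x"
      using x1 gD(1) by simp
    finally have glx: "g \<otimes>\<^bsub>R\<^esub> (l \<odot>\<^bsub>R\<^esub> x) = l \<odot>\<^bsub>R\<^esub> x"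
      using ax lx gD(1) by (simp add: R.m_closed)
    define z where "z = x \<oplus>\<^bsub>R\<^esub> \<ominus>\<^bsub>R\<^esub> (g \<otimes>\<^bsub>R\<^esub> x)"
    have gx: "g \<otimes>\<^bsub>R\<^esub> x \<in> carrier R" using x gD(1) by (simp add: R.m_closed)
    have z: "z \<in> carrier R" using x gx by (simp add: z_def)
    have "l \<odot>\<^bsub>R\<^esub> z = l \<odot>\<^bsub>R\<^esub> x \<oplus>\<^bsub>R\<^esub> \<ominus>\<^bsub>R\<^esub> (g \<otimes>\<^bsub>R\<^esub> (l \<odot>\<^bsub>R\<^esub> x))"
      using l x gx gD(1) by (simp add: z_def smult_r_distr smult_r_minus mult_smult)
    then have "l \<odot>\<^bsub>R\<^esub> z = \<zero>\<^bsub>R\<^esub>" using glx lx by (simp add: M.r_neg)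
    then have "proj_le R (central_cover R starR z) e" using tor[OF z] by blast
    moreover define c where "c = central_cover R starR z"
    ultimately have ce: "c \<otimes>\<^bsub>R\<^esub> e = c" by (simp add: proj_le_def)
    have "c \<in> central_projections R starR" and cz: "c \<otimes>\<^bsub>R\<^esub> z = z"
      using weakly_pq_baer_central_cover(1)[OF W z] by (auto simp: is_central_cover_def c_def)
    note cD = central_projectionsD[OF this(1)]
    have hz: "h \<otimes>\<^bsub>R\<^esub> z = \<zero>\<^bsub>R\<^esub>"
      using x gx hD(1) gD(1)
      by (simp add: z_def R.r_distr R.r_minus_mult R.m_assoc[symmetric] hg M.r_neg R.m_closed)
    have "e \<otimes>\<^bsub>R\<^esub> z = e \<otimes>\<^bsub>R\<^esub> (h \<otimes>\<^bsub>R\<^esub> z)"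
      using he hD(4)[OF ec] ec hD(1) z by (metis R.m_assoc)
    then have "c \<otimes>\<^bsub>R\<^esub> z = \<zero>\<^bsub>R\<^esub>"
      using ce cD(1) ec z hz by (metis R.m_assoc R.r_zero_mult)
    then have "z = \<zero>\<^bsub>R\<^esub>" using cz by simp
    then have "x = g \<otimes>\<^bsub>R\<^esub> x"
      using x gx M.minus_equality[of x "\<ominus>\<^bsub>R\<^esub> (g \<otimes>\<^bsub>R\<^esub> x)"] by (simp add: z_def)
    then show ?thesis by (rule sym)
  qed
  then show thesis using g that by blast
qed

theorem theorem3p9:
  fixes K :: "('k, 'n) ring_scheme" and starK :: "'k \<Rightarrow> 'k"
    and R :: "('k, 'a, 'm) module_scheme" and starR :: "'a \<Rightarrow> 'a"
  assumes "weakly_pq_baer_star_ring R starR"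
    and "star_algebra K starK R starR"
    and "\<And>l. \<lbrakk> l \<in> carrier K; l \<noteq> \<zero>\<^bsub>K\<^esub> \<rbrakk> \<Longrightarrow>
      \<exists>e\<in>projections R starR. \<forall>x\<in>carrier R.
        l \<odot>\<^bsub>R\<^esub> x = \<zero>\<^bsub>R\<^esub> \<longrightarrow> proj_le R (central_cover R starR x) e"
  shows "\<exists>(S :: ('a \<times> 'k) set ring) starS \<phi>.
    pq_baer_star_ring S starS \<and>
    \<phi> \<in> star_ring_hom R starR S starS \<and> inj_on \<phi> (carrier R) \<and>
    (\<forall>x\<in>carrier R. is_central_cover S starS (\<phi> x) (\<phi> (central_cover R starR x)))"
proof -
  interpret A: star_algebra K starK R starR by (rule assms(2))
  define S where "S = A.reduced_unitization"
  define starS where "starS = (\<lambda>X. A.star_unitization ` X)"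
  interpret E: faithful_star_extension R starR S starS A.embedding
    unfolding S_def starS_def
    by (rule A.faithful_star_extension_embedding; fact weakly_pq_baer_faithful[OF assms(1)])
  note cover = weakly_pq_baer_central_cover[OF assms(1)]
  have lift: "annihilation_cover S starS (A.embedding x) (A.embedding (central_cover R starR x))"
    if x: "x \<in> carrier R" for x
    using E.annihilation_cover_lift[OF x cover(2)[OF x]] cover(1)[OF x]
    by (simp add: is_central_cover_def)
  have "\<exists>p. annihilation_cover S starS s p" if s: "s \<in> carrier S" for s
  proof -
    obtain a l where a: "a \<in> carrier R" and l: "l \<in> carrier K"
      and s_eq: "s = A.action_kernel +>\<^bsub>A.unitization\<^esub> (a, l)"
      using s by (auto simp: S_def A.carrier_reduced_unitization)
    show ?thesis
    proof (cases "l = \<zero>\<^bsub>K\<^esub>")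
      case True
      then have "s = A.embedding a" by (simp add: s_eq A.embedding_def)
      then show ?thesis using lift[OF a] by blast
    next
      case False
      obtain e where e: "e \<in> projections R starR"
        and tor: "\<forall>x\<in>carrier R. l \<odot>\<^bsub>R\<^esub> x = \<zero>\<^bsub>R\<^esub> \<longrightarrow> proj_le R (central_cover R starR x) e"
        using assms(3)[OF l False] by blast
      obtain g where g: "g \<in> central_projections R starR"
        and ker: "\<And>x. \<lbrakk> x \<in> carrier R; A.left_action (a, l) x = \<zero>\<^bsub>R\<^esub> \<rbrakk> \<Longrightarrow> g \<otimes>\<^bsub>R\<^esub> x = x"
        using A.left_action_kernel_bounded[OF assms(1) a l e] tor by blast
      have act: "s \<otimes>\<^bsub>S\<^esub> A.embedding x = A.embedding (A.left_action (a, l) x)"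
        if "x \<in> carrier R" for x
        using A.coset_mult_embedding[of "(a, l)" x] a l that by (simp add: s_eq S_def)
      have ker': "g \<otimes>\<^bsub>R\<^esub> x = x"
        if x: "x \<in> carrier R" and "s \<otimes>\<^bsub>S\<^esub> A.embedding x = \<zero>\<^bsub>S\<^esub>" for x
        using ker[OF x] act[OF x] that(2) E.phi_eq_zero_iff[of "A.left_action (a, l) x"] a l x
        by simp
      have gc: "g \<in> carrier R" by (rule central_projectionsD[OF g])
      define b where "b = A.left_action (a, l) g"
      have b: "b \<in> carrier R" using a l gc by (simp add: b_def)
      show ?thesis
        using E.annihilation_cover_if_kernel_bounded[OF s g ker' b _ cover(2)[OF b] cover(1)[OF b]]
          act[OF gc] by (auto simp: b_def)
    qed
  qed
  then have "pq_baer_star_ring S starS" by (rule E.S.pq_baer_if_annihilation_covers)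
  moreover have "is_central_cover S starS (A.embedding x) (A.embedding (central_cover R starR x))"
    if "x \<in> carrier R" for x
    using E.S.annihilation_cover_imp_central_cover[OF E.phi_closed[OF that] lift[OF that]] .
  ultimately show ?thesis using E.hom E.inj by blast
qed

end
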